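(* Let $n\ge 6$ and $T_{6,n}=C_6\Box C_n$. Then $\chi(T_{6,n}^2)=6$.
   Context: $C_j$ denotes the cycle on $j$ vertices; $\Box$ is the Cartesian product of graphs. The square $G^2$ of a graph $G$ has vertex set $V(G)$, two distinct vertices being adjacent iff their distance in $G$ is at most 2. $\chi$ is the chromatic number. *)

theory Defs
  imports "Graph_Theory.Graph_Theory"
begin

text \<open>
  A finite simple graph is a digraph of the locale \<^locale>\<open>pair_graph\<close>: finite, without loops,
  with a symmetric arc relation.
\<close>

text \<open>
  The cycle on the vertices \<open>0, \<dots>, j - 1\<close>. It is only meant for \<open>j \<ge> 3\<close>; for \<open>j = 1\<close> the relation
  below is a loop and for \<open>j = 2\<close> a single edge.
\<close>

definition cycle_graph :: "nat \<Rightarrow> nat pair_pre_digraph" where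
  "cycle_graph j = \<lparr> pverts = {0..<j},
     parcs = {(u, v). u < j \<and> v < j \<and> (v = (u + 1) mod j \<or> u = (v + 1) mod j)} \<rparr>"

definition cartesian_product ::
  "'a pair_pre_digraph \<Rightarrow> 'b pair_pre_digraph \<Rightarrow> ('a \<times> 'b) pair_pre_digraph"
  (infixr \<open>\<box>\<close> 70) where
  "G \<box> H = \<lparr> pverts = pverts G \<times> pverts H,
     parcs = {((u, v), (u', v')).
       (u = u' \<and> u \<in> pverts G \<and> (v, v') \<in> parcs H) \<or>
       ((u, u') \<in> parcs G \<and> v = v' \<and> v \<in> pverts H)} \<rparr>"

text \<open>
  With all arcs of cost 1 the library's \<open>\<mu>\<close>, the infimum of the costs of the walks from \<open>u\<close> to \<open>v\<close>,
  is the usual distance, with value \<open>\<infinity>\<close> if there is no walk.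
\<close>

definition graph_dist :: "'a pair_pre_digraph \<Rightarrow> 'a \<Rightarrow> 'a \<Rightarrow> ereal" where
  "graph_dist G u v = wf_digraph.\<mu> (with_proj G) (\<lambda>_. 1) u v"

definition graph_square :: "'a pair_pre_digraph \<Rightarrow> 'a pair_pre_digraph" where
  "graph_square G = \<lparr> pverts = pverts G,
     parcs = {(u, v). u \<in> pverts G \<and> v \<in> pverts G \<and> u \<noteq> v \<and> graph_dist G u v \<le> 2} \<rparr>"

definition proper_coloring :: "'a pair_pre_digraph \<Rightarrow> nat \<Rightarrow> ('a \<Rightarrow> nat) \<Rightarrow> bool" where
  "proper_coloring G k c \<longleftrightarrow>
     c ` pverts G \<subseteq> {..<k} \<and> (\<forall>(u, v) \<in> parcs G. c u \<noteq> c v)"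

text \<open>
  The minimum exists for every finite loop-free graph, see \<open>ex_proper_coloring\<close> below.
\<close>

definition chromatic_number :: "'a pair_pre_digraph \<Rightarrow> nat" where
  "chromatic_number G = (LEAST k. \<exists>c. proper_coloring G k c)"

lemma (in pair_digraph) ex_proper_coloring: "\<exists>k c. proper_coloring G k c"
proof -
  obtain c :: "'a \<Rightarrow> nat" and k where c: "c ` pverts G = {i. i < k}" "inj_on c (pverts G)"
    using finite_imp_inj_to_nat_seg[OF pair_finite_verts] by blast
  have "c u \<noteq> c v" if "(u, v) \<in> parcs G" for u v
    using that c(2) in_arcsD1 in_arcsD2 pair_no_loops by (force dest: inj_onD)
  with c(1) have "proper_coloring G k c"
    by (auto simp: proper_coloring_def)
  then show ?thesis by blast
qed

lemma pair_graph_cycle_graph: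
  assumes "j \<ge> 3"
  shows "pair_graph (cycle_graph j)"
proof
  have "parcs (cycle_graph j) \<subseteq> {0..<j} \<times> {0..<j}"
    by (auto simp: cycle_graph_def)
  then show "finite (parcs (cycle_graph j))"
    by (rule finite_subset) simp
  show "fst e \<noteq> snd e" if "e \<in> parcs (cycle_graph j)" for e
    using that assms by (auto simp: cycle_graph_def mod_Suc split: if_splits)
  show "symmetric (cycle_graph j)"
    by (auto simp: cycle_graph_def symmetric_def sym_def)
qed (auto simp: cycle_graph_def)

lemma pair_graph_cartesian_product:
  assumes "pair_graph G" "pair_graph H"
  shows "pair_graph (G \<box> H)"
proof -
  interpret G: pair_graph G by fact
  interpret H: pair_graph H by fact
  show ?thesis
  proof
    have "parcs (G \<box> H) \<subseteq> (pverts G \<times> pverts H) \<times> (pverts G \<times> pverts H)"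
      by (auto simp: cartesian_product_def G.in_arcsD1 G.in_arcsD2 H.in_arcsD1 H.in_arcsD2)
    then show "finite (parcs (G \<box> H))"
      by (rule finite_subset) (simp add: G.pair_finite_verts H.pair_finite_verts)
    show "finite (pverts (G \<box> H))"
      by (simp add: cartesian_product_def G.pair_finite_verts H.pair_finite_verts)
    show "fst e \<noteq> snd e" if "e \<in> parcs (G \<box> H)" for e
      using that by (auto simp: cartesian_product_def dest: G.pair_no_loops H.pair_no_loops)
    show "symmetric (G \<box> H)"
      using G.pair_sym_arcs H.pair_sym_arcs
      by (auto simp: cartesian_product_def symmetric_def sym_def)
  qed (auto simp: cartesian_product_def G.in_arcsD1 G.in_arcsD2 H.in_arcsD1 H.in_arcsD2)
qed

end

theory Submission
  imports Defs
begin

text \<open>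
  Lower bound: two adjacent copies of \<open>C\<^sub>6\<close> contain 12 vertices, and among any three of them two are
  at distance at most 2. A colour class thus contains at most two of them, so 6 colours are needed.

  Upper bound: colour \<open>(x, y)\<close> by \<open>x + s y\<close> modulo 6. This is proper as soon as cyclically
  consecutive values of \<open>s\<close> differ by 2, 3 or 4 modulo 6 and values two apart are distinct.
  The blocks \<open>0, 2, 4\<close> and \<open>0, 2, 5, 3\<close> can be concatenated in any order, and every \<open>n \<ge> 6\<close> is a
  sum of 3s and 4s.
\<close>

section \<open>Adjacency in the square of a graph\<close>

lemma graph_square_arc_iff:
  assumes "pair_wf_digraph G"
  shows "(u, v) \<in> parcs (graph_square G) \<longleftrightarrow>
    u \<noteq> v \<and> ((u, v) \<in> parcs G \<or> (\<exists>w. (u, w) \<in> parcs G \<and> (w, v) \<in> parcs G))"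
    (is "_ \<longleftrightarrow> _ \<and> ?near")
proof -
  interpret pair_wf_digraph G by fact
  have cost: "awalk_cost (\<lambda>_. 1) p = real (length p)" for p :: "('a \<times> 'a) list"
    by (induction p) simp_all
  have dist: "graph_dist G u v = (INF p \<in> {p. awalk u p v}. ereal (real (length p)))"
    by (simp add: graph_dist_def \<mu>_def cost)
  have verts: "u \<in> pverts G \<and> v \<in> pverts G" if ?near
    using that in_arcsD1 in_arcsD2 by blast
  have "graph_dist G u v \<le> 2" if ?near
  proof -
    from that obtain p where p: "awalk u p v" "length p \<le> 2"
    proof (elim disjE exE conjE)
      assume "(u, v) \<in> parcs G"
      then show thesis
        using that[of "[(u, v)]"] verts[OF \<open>?near\<close>] by (simp add: awalk_simps)
    next
      fix w assume "(u, w) \<in> parcs G" "(w, v) \<in> parcs G"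
      then show thesis
        using that[of "[(u, w), (w, v)]"] verts[OF \<open>?near\<close>] by (simp add: awalk_simps)
    qed
    then show ?thesis
      unfolding dist by (intro INF_lower2[of p]) auto
  qed
  moreover have "?near" if "u \<noteq> v" "graph_dist G u v \<le> 2"
  proof (rule ccontr)
    assume far: "\<not> ?near"
    have "3 \<le> length p" if "awalk u p v" for p
    proof (rule ccontr)
      assume "\<not> 3 \<le> length p"
      then consider "p = []" | e where "p = [e]" | e f where "p = [e, f]"
        by (auto simp: not_le less_Suc_eq numeral_3_eq_3 length_Suc_conv)
      then show False
        using that \<open>u \<noteq> v\<close> far by cases (force simp: awalk_simps)+
    qed
    \<comment> \<open>Whether the infimum is attained does not matter: a lower bound of 3 on all
      walk lengths passes to it, even when there is no walk and the distance is infinite.\<close>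
    then have "3 \<le> graph_dist G u v"
      unfolding dist by (intro INF_greatest) (auto simp: numeral_eq_ereal)
    also have "\<dots> \<le> 2"
      by (rule that(2))
    finally show False
      by simp
  qed
  ultimately show ?thesis
    using verts by (auto simp: graph_square_def)
qed

section \<open>Lower bound by counting colour classes\<close>

lemma chromatic_number_eqI:
  assumes "proper_coloring G k c" "\<And>m d. proper_coloring G m d \<Longrightarrow> k \<le> m"
  shows "chromatic_number G = k"
  unfolding chromatic_number_def using assms by (blast intro: Least_equality)

lemma card_le_mult_card_fibre:
  assumes "f ` A \<subseteq> {..<k}" "finite A"
    and "\<And>i. card {a \<in> A. f a = i} \<le> m"
  shows "card A \<le> k * m"
proof -
  have "card A = card (\<Union>i<k. {a \<in> A. f a = i})"
    using assms(1) by (intro arg_cong[where f = card]) auto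
  also have "\<dots> \<le> (\<Sum>i<k. card {a \<in> A. f a = i})"
    by (rule card_UN_le) simp
  also have "\<dots> \<le> (\<Sum>i<k. m)"
    by (rule sum_mono) (rule assms(3))
  finally show ?thesis by simp
qed

lemma pair_wf_digraph_torus:
  assumes "m \<ge> 3" "n \<ge> 3"
  shows "pair_wf_digraph (cycle_graph m \<box> cycle_graph n)"
proof -
  interpret pair_graph "cycle_graph m \<box> cycle_graph n"
    using assms by (intro pair_graph_cartesian_product pair_graph_cycle_graph)
  show ?thesis
    by unfold_locales
qed

text \<open>Serves to split claims about residues modulo 6 into six concrete cases.\<close>

lemma less_6_cases: "x < 6 \<longleftrightarrow> x \<in> {0, 1, 2, 3, 4, 5 :: nat}"
  by auto

lemma six_le_colors:
  assumes "n \<ge> 3" "proper_coloring (graph_square (cycle_graph 6 \<box> cycle_graph n)) k c"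
  shows "6 \<le> k"
proof -
  let ?G = "cycle_graph 6 \<box> cycle_graph n"
  define V :: "(nat \<times> nat) set" where "V = {..<6} \<times> {..<2}"
  have "V \<subseteq> pverts ?G"
    using assms(1) by (auto simp: V_def cartesian_product_def cycle_graph_def)
  then have "c ` V \<subseteq> {..<k}"
    using assms(2) by (auto simp: proper_coloring_def graph_square_def)
  have differ: "c u \<noteq> c v"
    if "u \<noteq> v" "(u, v) \<in> parcs ?G \<or> (\<exists>w. (u, w) \<in> parcs ?G \<and> (w, v) \<in> parcs ?G)" for u v
  proof -
    have "(u, v) \<in> parcs (graph_square ?G)"
      using that assms(1) by (simp add: graph_square_arc_iff[OF pair_wf_digraph_torus])
    then show ?thesis
      using assms(2) by (auto simp: proper_coloring_def)
  qed
  have step: "((x, y), (x', y)) \<in> parcs ?G"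
    if "x < 6" "x' < 6" "y < 2" "x' = (x + 1) mod 6 \<or> x = (x' + 1) mod 6" for x x' y
    using that assms(1) by (auto simp: cartesian_product_def cycle_graph_def)
  have cross: "((x, y), (x, y')) \<in> parcs ?G" if "x < 6" "y < 2" "y' < 2" "y \<noteq> y'" for x y y'
    using that assms(1)
    by (auto simp: cartesian_product_def cycle_graph_def less_2_cases_iff)
  \<comment> \<open>In \<open>C_6\<close> only the antipode of a vertex is at distance more than
    2.\<close>
  have same_row: "x' = (x + 3) mod 6"
    if "x < 6" "x' < 6" "y < 2" "x \<noteq> x'" "c (x, y) = c (x', y)" for x x' y
  proof (rule ccontr)
    assume "x' \<noteq> (x + 3) mod 6"
    with \<open>x < 6\<close> \<open>x' < 6\<close> \<open>x \<noteq> x'\<close> have "x' = (x + 1) mod 6 \<or> x = (x' + 1) mod 6 \<or>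
        x' = ((x + 1) mod 6 + 1) mod 6 \<or> x = ((x' + 1) mod 6 + 1) mod 6"
      unfolding less_6_cases by (elim insertE emptyE) simp_all
    then consider "x' = (x + 1) mod 6 \<or> x = (x' + 1) mod 6"
      | "x' = ((x + 1) mod 6 + 1) mod 6" | "x = ((x' + 1) mod 6 + 1) mod 6"
      by blast
    then show False
    proof cases
      case 1
      then show False
        using that step differ by blast
    next
      case 2
      then show False
        using that step[of x "(x + 1) mod 6" y] step[of "(x + 1) mod 6" x' y]
          differ[of "(x, y)" "(x', y)"] by auto
    next
      case 3
      then show False
        using that step[of x "(x' + 1) mod 6" y] step[of "(x' + 1) mod 6" x' y]
          differ[of "(x, y)" "(x', y)"] by auto
    qed
  qed
  \<comment> \<open>Equal columns are joined by one arc across the rows, neighbouring columns by an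
    arc along the row followed by one across.\<close>
  have other_row: "x' \<noteq> x \<and> x' \<noteq> (x + 1) mod 6 \<and> x \<noteq> (x' + 1) mod 6"
    if "x < 6" "x' < 6" "y < 2" "y' < 2" "y \<noteq> y'" "c (x, y) = c (x', y')" for x x' y y'
    using that step[of x x' y] cross[of x y y'] cross[of x' y y'] differ[of "(x, y)" "(x', y')"]
    by blast
  have "card {v \<in> V. c v = i} \<le> 2" for i
  proof (rule ccontr)
    assume "\<not> ?thesis"
    then have "3 \<le> card {v \<in> V. c v = i}"
      by simp
    then obtain S where S: "S \<subseteq> {v \<in> V. c v = i}" "card S = 3"
      by (meson obtain_subset_with_card_n)
    obtain u v w where uvw: "S = {u, v, w}" "u \<noteq> v" "u \<noteq> w" "v \<noteq> w"
      using S(2) by (auto simp: card_3_iff)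
    obtain x1 y1 x2 y2 x3 y3 where [simp]: "u = (x1, y1)" "v = (x2, y2)" "w = (x3, y3)"
      by (metis surj_pair)
    have bounds: "x1 < 6" "x2 < 6" "x3 < 6" "y1 < 2" "y2 < 2" "y3 < 2"
      and eq: "c (x1, y1) = i" "c (x2, y2) = i" "c (x3, y3) = i"
      using S(1) uvw(1) by (auto simp: V_def)
    \<comment> \<open>Two vertices of one colour in one row are antipodal. A third vertex in that
      row would have to coincide with one of them; in the other row it conflicts, as every vertex of
      \<open>C_6\<close> is equal or adjacent to \<open>x\<close> or to its antipode.\<close>
    have no_three: False
      if "x < 6" "x' < 6" "z < 6" "y < 2" "y' < 2" "x \<noteq> x'" "(z, y') \<noteq> (x, y)" "(z, y') \<noteq> (x', y)"
        "c (x, y) = i" "c (x', y) = i" "c (z, y') = i" for x x' z y y'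
    proof -
      have x': "x' = (x + 3) mod 6"
        using that same_row by metis
      show False
      proof (cases "y = y'")
        case True
        then have "z = (x + 3) mod 6"
          using that same_row[of x z y] by auto
        with x' True that show False by simp
      next
        case False
        then have "z \<noteq> x \<and> z \<noteq> (x + 1) mod 6 \<and> x \<noteq> (z + 1) mod 6"
          "z \<noteq> x' \<and> z \<noteq> (x' + 1) mod 6 \<and> x' \<noteq> (z + 1) mod 6"
          using that other_row[of x z y y'] other_row[of x' z y y'] by auto
        with x' that(1,3) show False
          unfolding less_6_cases by (elim insertE emptyE) simp_all
      qed
    qed
    \<comment> \<open>Three vertices in two rows: some two share a row and play the first two roles
      in \<open>no_three\<close>.\<close>
    consider "y1 = y2" | "y1 = y3" | "y2 = y3"
      using bounds(4-6) by linarith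
    then show False
      using no_three[of x1 x2 x3 y1 y3] no_three[of x1 x3 x2 y1 y2] no_three[of x2 x3 x1 y2 y1]
        bounds eq uvw(2-4) by cases auto
  qed
  then have "card V \<le> k * 2"
    using \<open>c ` V \<subseteq> {..<k}\<close> by (intro card_le_mult_card_fibre) (auto simp: V_def)
  then show ?thesis
    by (simp add: V_def)
qed

section \<open>Colourings by shifted rows\<close>

lemma proper_coloring_shifts:
  fixes s :: "nat \<Rightarrow> nat"
  assumes "n \<ge> 3"
    and shift1: "\<And>y. y < n \<Longrightarrow> (int (s ((y + 1) mod n)) - int (s y)) mod 6 \<in> {2, 3, 4}"
    and shift2: "\<And>y. y < n \<Longrightarrow> (int (s ((y + 2) mod n)) - int (s y)) mod 6 \<noteq> 0"
  shows "proper_coloring (graph_square (cycle_graph 6 \<box> cycle_graph n)) 6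
    (\<lambda>(x, y). (x + s y) mod 6)"
proof -
  define E where "E j = parcs (cycle_graph j)" for j
  let ?G = "cycle_graph 6 \<box> cycle_graph n"
  \<comment> \<open>The set {2, 3, 4} is closed under negation modulo 6, so the direction of the
    step is irrelevant.\<close>
  have E_step: "(int (s y') - int (s y)) mod 6 \<in> {2, 3, 4}" if "(y, y') \<in> E n" for y y'
  proof -
    have "y' < n" "y < n" "y' = (y + 1) mod n \<or> y = (y' + 1) mod n"
      using that by (auto simp: E_def cycle_graph_def)
    then have "(int (s y') - int (s y)) mod 6 \<in> {2, 3, 4} \<or> (int (s y) - int (s y')) mod 6 \<in> {2, 3, 4}"
      using shift1 by metis
    then show ?thesis
      by (simp only: insert_iff empty_iff) presburger
  qed
  have E_step2: "(int (s y') - int (s y)) mod 6 \<noteq> 0"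
    if yz: "(y, z) \<in> E n" "(z, y') \<in> E n" "y \<noteq> y'" for y z y'
  proof -
    have lt: "y < n" "y' < n" "z < n"
      using yz by (auto simp: E_def cycle_graph_def)
    \<comment> \<open>Both steps go the same way around the cycle, since opposite steps would return
      to \<open>y\<close>.\<close>
    have "y' = (y + 2) mod n \<or> y = (y' + 2) mod n"
    proof -
      have inj: "a = b" if "(a + 1) mod n = (b + 1) mod n" "a < n" "b < n" for a b
        using that by (auto simp: mod_Suc split: if_splits)
      have two: "((a + 1) mod n + 1) mod n = (a + 2) mod n" for a
        by (simp add: mod_simps)
      have "z = (y + 1) mod n \<or> y = (z + 1) mod n" "y' = (z + 1) mod n \<or> z = (y' + 1) mod n"
        using yz by (auto simp: E_def cycle_graph_def)
      with inj[OF _ lt(1,2)] two yz(3) show ?thesis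
        by metis
    qed
    then have "(int (s y') - int (s y)) mod 6 \<noteq> 0 \<or> (int (s y) - int (s y')) mod 6 \<noteq> 0"
      using shift2 lt by metis
    then show ?thesis
      by presburger
  qed
  have C6_step: "(int x' - int x) mod 6 \<in> {1, 5}" if "(x, x') \<in> E 6" for x x'
  proof -
    have "x' = (x + 1) mod 6 \<or> x = (x' + 1) mod 6"
      using that by (auto simp: E_def cycle_graph_def)
    then have "int x' = (int x + 1) mod 6 \<or> int x = (int x' + 1) mod 6"
      by (auto simp: zmod_int ac_simps)
    then show ?thesis
      by (auto simp: mod_simps)
  qed
  have lt6: "x < 6 \<and> x' < 6" if "(x, x') \<in> E 6" for x x'
    using that by (auto simp: E_def cycle_graph_def)
  have arc: "x = x' \<and> (y, y') \<in> E n \<or> (x, x') \<in> E 6 \<and> y = y'"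
    if "((x, y), (x', y')) \<in> parcs ?G" for x y x' y'
    using that by (auto simp: cartesian_product_def E_def)
  have differ: "(x + s y) mod 6 \<noteq> (x' + s y') mod 6"
    if "((x, y), (x', y')) \<in> parcs (graph_square ?G)" for x y x' y'
  proof -
    have ne: "(x, y) \<noteq> (x', y')"
      and "((x, y), (x', y')) \<in> parcs ?G \<or>
        (\<exists>w. ((x, y), w) \<in> parcs ?G \<and> (w, (x', y')) \<in> parcs ?G)"
      using that assms(1) by (auto simp: graph_square_arc_iff[OF pair_wf_digraph_torus])
    \<comment> \<open>Walks of two arcs that change both coordinates, in either order, form the
      fourth case. There a difference of 1 or 5 cannot cancel one of 2, 3 or 4 modulo 6.\<close>
    then consider
        "x = x'" "(y, y') \<in> E n" | "(x, x') \<in> E 6" "y = y'"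
      | z where "x = x'" "(y, z) \<in> E n" "(z, y') \<in> E n"
      | "(x, x') \<in> E 6" "(y, y') \<in> E n"
      | z where "(x, z) \<in> E 6" "(z, x') \<in> E 6" "y = y'"
      by (auto dest!: arc)
    then have "(int x' - int x + (int (s y') - int (s y))) mod 6 \<noteq> 0"
    proof cases
      case 1
      then show ?thesis
        using E_step[of y y'] by auto
    next
      case 2
      then show ?thesis
        using C6_step[of x x'] by auto
    next
      case (3 z)
      then show ?thesis
        using E_step2[of y z y'] ne by auto
    next
      case 4
      define a b where "a = int x' - int x" and "b = int (s y') - int (s y)"
      have "a mod 6 \<in> {1, 5}" "b mod 6 \<in> {2, 3, 4}"
        unfolding a_def b_def by (rule C6_step E_step, fact)+
      then have "(a + b) mod 6 \<noteq> 0"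
        by (simp only: insert_iff empty_iff) presburger
      then show ?thesis
        by (simp add: a_def b_def)
    next
      case (5 z)
      then have "int x' mod 6 \<noteq> int x mod 6"
        using lt6 ne by auto
      with 5 show ?thesis
        by (simp add: mod_eq_dvd_iff dvd_eq_mod_eq_0)
    qed
    then have "int (x' + s y') mod 6 \<noteq> int (x + s y) mod 6"
      by (simp add: mod_eq_dvd_iff dvd_eq_mod_eq_0 algebra_simps)
    then show ?thesis
      by (metis of_nat_mod of_nat_numeral)
  qed
  then show ?thesis
    by (auto simp: proper_coloring_def)
qed

section \<open>A shift sequence for every length at least 6\<close>

text \<open>The first \<open>k\<close> blocks have length 3; blocks of length 4 then repeat forever.
  The length \<open>n\<close> is not a parameter, so closing the sequence up to a cycle is left to
  \<open>shift_periodic\<close>.\<close>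

definition shift :: "nat \<Rightarrow> nat \<Rightarrow> nat" where
  "shift k y = (if y < 3 * k then [0, 2, 4] ! (y mod 3) else [0, 2, 5, 3] ! ((y - 3 * k) mod 4))"

lemma shift_before:
  assumes "q < k"
  shows "shift k (3 * q) = 0" "shift k (3 * q + 1) = 2" "shift k (3 * q + 2) = 4"
  using assms by (simp_all add: shift_def mod_Suc)

lemma shift_after:
  "shift k (3 * k + 4 * p) = 0" "shift k (3 * k + 4 * p + 1) = 2"
  "shift k (3 * k + 4 * p + 2) = 5" "shift k (3 * k + 4 * p + 3) = 3"
proof -
  have "shift k (3 * k + 4 * p + l) = [0, 2, 5, 3] ! l" if "l < 4" for l
    using that by (simp add: shift_def)
  from this[of 0] this[of 1] this[of 2] this[of 3]
  show "shift k (3 * k + 4 * p) = 0" "shift k (3 * k + 4 * p + 1) = 2"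
    "shift k (3 * k + 4 * p + 2) = 5" "shift k (3 * k + 4 * p + 3) = 3"
    by simp_all
qed

text \<open>Both kinds of block begin with 0, 2, so the values also hold at \<open>q = k\<close>,
  where the blocks of length 4 start.\<close>

lemma shift_upto:
  assumes "q \<le> k"
  shows "shift k (3 * q) = 0" "shift k (3 * q + 1) = 2"
  using assms shift_before[of q k] shift_after(1,2)[of k 0] by (cases "q = k"; simp)+

text \<open>Every block is followed by 0, 2, whichever block comes next. The windows are thus those
  of 0, 2, 4, 0, 2 and of 0, 2, 5, 3, 0, 2.\<close>

lemma shift_window:
  "(shift k y, shift k (y + 1), shift k (y + 2)) \<in>
    {(0, 2, 4), (2, 4, 0), (4, 0, 2), (0, 2, 5), (2, 5, 3), (5, 3, 0), (3, 0, 2)}"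
proof (cases "y < 3 * k")
  case True
  define q where "q = y div 3"
  have "q < k"
    using True unfolding q_def by linarith
  then have "shift k (3 * q + 3) = 0" "shift k (3 * q + 4) = 2"
    using shift_upto[of "Suc q" k] by (simp_all add: add.commute)
  with shift_before[OF \<open>q < k\<close>]
  obtain b where "b = 3 * q" "shift k b = 0" "shift k (b + 1) = 2" "shift k (b + 2) = 4"
    "shift k (b + 3) = 0" "shift k (b + 4) = 2"
    by blast
  moreover from this(1) have "y = b \<or> y = b + 1 \<or> y = b + 2"
    unfolding q_def by linarith
  ultimately show ?thesis
    by (elim disjE) (simp_all add: numeral_eq_Suc)
next
  case False
  define p where "p = (y - 3 * k) div 4"
  have "shift k (3 * k + 4 * p + 4) = 0" "shift k (3 * k + 4 * p + 5) = 2"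
    using shift_after(1,2)[of k "Suc p"] by (simp_all add: ac_simps)
  with shift_after[of k p]
  obtain b where "b = 3 * k + 4 * p" "shift k b = 0" "shift k (b + 1) = 2" "shift k (b + 2) = 5"
    "shift k (b + 3) = 3" "shift k (b + 4) = 0" "shift k (b + 5) = 2"
    by blast
  moreover from this(1) have "y = b \<or> y = b + 1 \<or> y = b + 2 \<or> y = b + 3"
    using False unfolding p_def by linarith
  ultimately show ?thesis
    by (elim disjE) (simp_all add: numeral_eq_Suc)
qed

lemma shift_Suc: "(int (shift k (y + 1)) - int (shift k y)) mod 6 \<in> {2, 3, 4}"
  using shift_window[of k y] by auto

lemma shift_add_2: "(int (shift k (y + 2)) - int (shift k y)) mod 6 \<noteq> 0"
  using shift_window[of k y] by auto

text \<open>At \<open>n\<close> a new block would begin, with the same 0, 2 as at position 0.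
  Windows starting below \<open>n\<close> reach at most \<open>n + 1\<close>, so these two positions
  suffice.\<close>

lemma shift_periodic:
  assumes "n = 3 * k + 4 * r" "n \<ge> 6" "y < n + 2"
  shows "shift k (y mod n) = shift k y"
proof (cases "y < n")
  case False
  then have "y = n \<or> y = n + 1"
    using assms(3) by auto
  then show ?thesis
    using assms(1,2) shift_upto[of 0 k] shift_after(1,2)[of k r] by (auto simp: mod_Suc)
qed simp

lemma sum_of_3s_4s:
  assumes "n \<ge> (6 :: nat)"
  obtains k r where "n = 3 * k + 4 * r"
proof -
  \<comment> \<open>Lengthening \<open>n mod 3\<close> of the \<open>n div 3\<close> threes to fours
    absorbs the remainder; there are enough threes because the quotient is at least 2.\<close>
  have "n mod 3 \<le> n div 3"
    using assms by linarith
  then have "n = 3 * (n div 3 - n mod 3) + 4 * (n mod 3)"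
    by (simp add: diff_mult_distrib2)
  then show thesis by (rule that)
qed

theorem theorem8:
  fixes n :: nat
  assumes "n \<ge> 6"
  shows "chromatic_number (graph_square (cycle_graph 6 \<box> cycle_graph n)) = 6"
proof -
  obtain k r where n: "n = 3 * k + 4 * r"
    using assms by (rule sum_of_3s_4s)
  have "shift k ((y + 1) mod n) = shift k (y + 1)" "shift k ((y + 2) mod n) = shift k (y + 2)"
    if "y < n" for y
    using that assms by (auto intro!: shift_periodic[OF n])
  then have "proper_coloring (graph_square (cycle_graph 6 \<box> cycle_graph n)) 6
      (\<lambda>(x, y). (x + shift k y) mod 6)"
    using assms shift_Suc shift_add_2 by (intro proper_coloring_shifts) simp_all
  then show ?thesis
    using six_le_colors[of n] assms by (intro chromatic_number_eqI) simp_all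
qed

end
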